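(* Let $P$ be the condensation measure on $\mathbb{R}$ satisfying $P=\frac13 P\circ S_1^{-1}+\frac13 P\circ S_2^{-1}+\frac13\nu$, with $S_1(x)=\frac15x$, $S_2(x)=\frac15x+\frac45$, where $\nu$ is the self-similar probability measure satisfying $\nu=\frac12\nu\circ T_1^{-1}+\frac12\nu\circ T_2^{-1}$ with $T_1(x)=\frac13x+\frac4{15}$, $T_2(x)=\frac13x+\frac25$. Then $\lim_{n\to\infty}\frac{2\log n}{-\log V_n(P)}=D(\nu)$; that is, the quantization dimension $D(P)$ of $P$ exists and is equal to $D(\nu)$, where $D(\nu)=\frac{\log 2}{\log 3}$ is the quantization dimension of $\nu$.
   Context: For a Borel probability measure $\mu$ on $\mathbb{R}$ with compact support, $V_n(\mu)=\inf\{\int\min_{a\in\alpha}(x-a)^2\,d\mu(x):\alpha\subset\mathbb{R},\ 1\le\mathrm{card}(\alpha)\le n\}$ is the $n$th quantization error, and the quantization dimension is $D(\mu)=\lim_{n\to\infty}\frac{2\log n}{-\log V_n(\mu)}$ if the limit exists. The measures $\nu$ and $P$ are the unique compactly supported Borel probability measures satisfying the displayed identities. *)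

theory Defs
  imports "HOL-Probability.Probability"
begin

definition topological_support :: "'a::topological_space measure \<Rightarrow> 'a set" where
  "topological_support M = {x. \<forall>U. open U \<and> x \<in> U \<longrightarrow> emeasure M U > 0}"

definition compactly_supported_distribution :: "real measure \<Rightarrow> bool" where
  "compactly_supported_distribution M \<longleftrightarrow>
     real_distribution M \<and> compact (topological_support M)"

(* The integrand is bounded on a compact support, so for the measures considered here the
   Bochner integral is the true one and the set below is bounded below by 0.
   For n = 0 the set is empty and the value is irrelevant. *)
definition quantization_error :: "nat \<Rightarrow> real measure \<Rightarrow> real" where
  "quantization_error n M =
     Inf {(LINT x|M. Min ((\<lambda>a. (x - a)\<^sup>2) ` \<alpha>)) | \<alpha> :: real set.
            finite \<alpha> \<and> 1 \<le> card \<alpha> \<and> card \<alpha> \<le> n}"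

definition quantization_ratio :: "real measure \<Rightarrow> nat \<Rightarrow> real" where
  "quantization_ratio M n = 2 * ln (real n) / (- ln (quantization_error n M))"

definition quantization_dim_exists :: "real measure \<Rightarrow> bool" where
  "quantization_dim_exists M \<longleftrightarrow> convergent (quantization_ratio M)"

(* Meaningful only if quantization_dim_exists M. *)
definition quantization_dim :: "real measure \<Rightarrow> real" where
  "quantization_dim M = lim (quantization_ratio M)"

definition S\<^sub>1 :: "real \<Rightarrow> real" where "S\<^sub>1 x = 1/5 * x"
definition S\<^sub>2 :: "real \<Rightarrow> real" where "S\<^sub>2 x = 1/5 * x + 4/5"
definition T\<^sub>1 :: "real \<Rightarrow> real" where "T\<^sub>1 x = 1/3 * x + 4/15"
definition T\<^sub>2 :: "real \<Rightarrow> real" where "T\<^sub>2 x = 1/3 * x + 2/5"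

definition is_self_similar_measure :: "real measure \<Rightarrow> bool" where
  "is_self_similar_measure \<nu> \<longleftrightarrow>
     compactly_supported_distribution \<nu> \<and>
     (\<forall>A \<in> sets borel. measure \<nu> A =
        1/2 * measure (distr \<nu> borel T\<^sub>1) A + 1/2 * measure (distr \<nu> borel T\<^sub>2) A)"

definition is_condensation_measure :: "real measure \<Rightarrow> real measure \<Rightarrow> bool" where
  "is_condensation_measure \<nu> P \<longleftrightarrow>
     compactly_supported_distribution P \<and>
     (\<forall>A \<in> sets borel. measure P A =
        1/3 * measure (distr P borel S\<^sub>1) A + 1/3 * measure (distr P borel S\<^sub>2) A
        + 1/3 * measure \<nu> A)"

end

theory Submission
  imports Defs "HOL-Real_Asymp.Real_Asymp"
begin

text \<open>
  Splitting \<open>P\<close> along its condensation identity, a quantizer \<open>\<beta>\<close> of \<open>P\<close> and a quantizer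
  \<open>\<gamma>\<close> of \<open>\<nu>\<close> give the quantizer \<open>S\<^sub>1 \<beta> \<union> S\<^sub>2 \<beta> \<union> \<gamma>\<close> of \<open>P\<close>, with distortion at most
  \<open>2/75\<close> of the former plus \<open>1/3\<close> of the latter. Likewise \<open>T\<^sub>1 \<beta> \<union> T\<^sub>2 \<beta>\<close> scales the distortion
  for \<open>\<nu>\<close> by \<open>1/9\<close>. As \<open>2/75 < 1/9\<close>, the term coming from \<open>\<nu>\<close> dominates: \<open>(k + 1) 2\<^sup>k\<close> points
  suffice for a distortion of order \<open>9\<^sup>-\<^sup>k\<close>, both for \<open>\<nu>\<close> and for \<open>P\<close>. In the other direction, an
  interval of length of order \<open>3\<^sup>-\<^sup>k\<close> has \<open>\<nu>\<close>-measure at most \<open>2\<^sup>-\<^sup>k\<close>, so \<open>2\<^sup>k\<^sup>-\<^sup>1\<close> points cannot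
  achieve a \<open>\<nu>\<close>-distortion below order \<open>9\<^sup>-\<^sup>k\<close>; since \<open>P \<ge> \<nu>/3\<close>, the same holds for \<open>P\<close>. The
  factor \<open>k + 1\<close> is invisible on the logarithmic scale.
\<close>

section \<open>Compact supports and mixtures\<close>

text \<open>The complement of the support is the union of all open null sets. By the Lindelof
  property countably many of them already cover it, so it is null.\<close>

lemma AE_in_topological_support:
  fixes M :: "'a::second_countable_topology measure"
  assumes "sets M = sets borel"
  shows "AE x in M. x \<in> topological_support M"
proof -
  define F where "F = {U. open U \<and> emeasure M U = 0}"
  obtain F' where F': "F' \<subseteq> F" "countable F'" "\<Union>F' = \<Union>F"
    using Lindelof[of F] unfolding F_def by auto
  have "U \<in> null_sets M" if "U \<in> F'" for U
    using that F' assms by (auto simp: F_def null_sets_def)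
  then have "(\<Union>U\<in>F'. U) \<in> null_sets M"
    using F' by (intro null_sets_UN') auto
  then have "AE x in M. x \<notin> \<Union>F'"
    by (intro AE_not_in) simp
  then show ?thesis
    by (rule eventually_mono)
       (auto simp: F' topological_support_def F_def zero_less_iff_neq_zero)
qed

lemma compactly_supported_distribution_bounded:
  assumes "compactly_supported_distribution M"
  obtains R where "R > 0" "AE x in M. \<bar>x\<bar> \<le> R"
proof -
  interpret real_distribution M
    using assms by (simp add: compactly_supported_distribution_def)
  have "bounded (topological_support M)"
    using assms by (simp add: compactly_supported_distribution_def compact_imp_bounded)
  then obtain R where "R > 0" "\<And>x. x \<in> topological_support M \<Longrightarrow> \<bar>x\<bar> \<le> R"
    unfolding bounded_pos by auto
  then show thesis
    using that AE_in_topological_support[of M] by (metis (mono_tags, lifting) eventually_mono events_eq_borel)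
qed

text \<open>The identities defining \<open>\<nu>\<close> and \<open>P\<close> are given on sets
  only; this carries them over to integrals, by induction from indicators through scaling and sums
  to increasing limits. In the limit step the finite sum commutes with the supremum because the
  sequences increase.\<close>

lemma nn_integral_mixture:
  fixes w :: "'i \<Rightarrow> ennreal"
  assumes "finite I" and sets: "\<And>i. i \<in> I \<Longrightarrow> sets (N i) = sets M"
    and mix: "\<And>A. A \<in> sets M \<Longrightarrow> emeasure M A = (\<Sum>i\<in>I. w i * emeasure (N i) A)"
    and f: "f \<in> borel_measurable M"
  shows "nn_integral M f = (\<Sum>i\<in>I. w i * nn_integral (N i) f)"
proof -
  have meas: "g \<in> borel_measurable (N i)" if "i \<in> I" "g \<in> borel_measurable M" for g :: "'a \<Rightarrow> ennreal" and i
    using measurable_cong_sets[OF sets[OF that(1)] refl] that(2) by blast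
  show ?thesis
    using f
  proof (induction rule: borel_measurable_induct)
    case (cong f g)
    have "nn_integral (N i) f = nn_integral (N i) g" if "i \<in> I" for i
      using cong(3) sets_eq_imp_space_eq[OF sets[OF that]] by (intro nn_integral_cong) auto
    moreover have "nn_integral M f = nn_integral M g"
      using cong(3) by (intro nn_integral_cong) auto
    ultimately show ?case using cong by simp
  next
    case (set A)
    then show ?case using mix sets by (auto intro!: sum.cong)
  next
    case (mult u c)
    have "w i * (\<integral>\<^sup>+x. c * u x \<partial>N i) = c * (w i * nn_integral (N i) u)" if "i \<in> I" for i
      using meas[OF that mult.hyps(2)] by (simp add: nn_integral_cmult mult.left_commute)
    then have "(\<Sum>i\<in>I. w i * (\<integral>\<^sup>+x. c * u x \<partial>N i)) = c * nn_integral M u"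
      unfolding mult.IH sum_distrib_left by (intro sum.cong refl)
    then show ?case using mult.hyps by (simp add: nn_integral_cmult)
  next
    case (add u v)
    have "w i * (\<integral>\<^sup>+x. v x + u x \<partial>N i) = w i * nn_integral (N i) v + w i * nn_integral (N i) u"
      if "i \<in> I" for i
      using meas[OF that add.hyps(1)] meas[OF that add.hyps(3)]
      by (simp add: nn_integral_add distrib_left)
    then have "(\<Sum>i\<in>I. w i * (\<integral>\<^sup>+x. v x + u x \<partial>N i)) =
        (\<Sum>i\<in>I. w i * nn_integral (N i) v + w i * nn_integral (N i) u)"
      by (intro sum.cong refl)
    also have "\<dots> = nn_integral M v + nn_integral M u"
      by (simp only: add.IH sum.distrib)
    finally show ?case
      using add.hyps(1,3) by (simp add: nn_integral_add)
  next
    case (seq U)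
    have U: "U j \<in> borel_measurable (N i)" if "i \<in> I" for i j
      by (rule meas[OF that seq.hyps(1)])
    have lim: "nn_integral K (SUP j. U j) = (SUP j. nn_integral K (U j))"
      if "\<And>j. U j \<in> borel_measurable K" for K
    proof -
      have "(SUP j. U j) = (\<lambda>x. SUP j. U j x)" by (auto simp: fun_eq_iff image_comp)
      then show ?thesis using nn_integral_monotone_convergence_SUP[OF seq.hyps(3) that] by simp
    qed
    have "nn_integral M (SUP j. U j) = (SUP j. nn_integral M (U j))"
      by (rule lim[OF seq.hyps(1)])
    also have "\<dots> = (SUP j. \<Sum>i\<in>I. w i * nn_integral (N i) (U j))"
      by (simp only: seq.IH)
    also have "\<dots> = (\<Sum>i\<in>I. SUP j. w i * nn_integral (N i) (U j))"
      using seq.hyps(3)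
      by (intro ennreal_SUP_sum)
         (auto simp: incseq_def le_fun_def intro!: mult_left_mono nn_integral_mono)
    also have "\<dots> = (\<Sum>i\<in>I. w i * (SUP j. nn_integral (N i) (U j)))"
      by (simp add: SUP_mult_left_ennreal)
    also have "\<dots> = (\<Sum>i\<in>I. w i * nn_integral (N i) (SUP j. U j))"
      using lim[OF U] by (intro sum.cong refl) simp
    finally show ?case .
  qed
qed

text \<open>Nonnegativity of \<open>f\<close> allows the passage through \<open>nn_integral\<close>.
  Integrability is assumed for the components only; over \<open>M\<close> it follows because the
  resulting sum is finite.\<close>

lemma integral_mixture:
  fixes w :: "'i \<Rightarrow> real" and f :: "'a \<Rightarrow> real"
  assumes "finite I" and w: "\<And>i. i \<in> I \<Longrightarrow> 0 \<le> w i"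
    and "finite_measure M" and fin: "\<And>i. i \<in> I \<Longrightarrow> finite_measure (N i)"
    and sets: "\<And>i. i \<in> I \<Longrightarrow> sets (N i) = sets M"
    and mix: "\<And>A. A \<in> sets M \<Longrightarrow> measure M A = (\<Sum>i\<in>I. w i * measure (N i) A)"
    and f: "f \<in> borel_measurable M" "\<And>x. 0 \<le> f x" "\<And>i. i \<in> I \<Longrightarrow> integrable (N i) f"
  shows "integral\<^sup>L M f = (\<Sum>i\<in>I. w i * integral\<^sup>L (N i) f)"
proof -
  interpret finite_measure M by fact
  have "emeasure M A = (\<Sum>i\<in>I. ennreal (w i) * emeasure (N i) A)" if "A \<in> sets M" for A
    using mix[OF that] w fin
    by (simp add: emeasure_eq_measure finite_measure.emeasure_eq_measure flip: ennreal_mult' sum_ennreal)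
  then have "(\<integral>\<^sup>+x. ennreal (f x) \<partial>M) = (\<Sum>i\<in>I. ennreal (w i) * (\<integral>\<^sup>+x. ennreal (f x) \<partial>N i))"
    using assms(1) sets f(1) by (intro nn_integral_mixture) auto
  also have "\<dots> = (\<Sum>i\<in>I. ennreal (w i * integral\<^sup>L (N i) f))"
    using w f by (intro sum.cong refl) (simp add: nn_integral_eq_integral ennreal_mult')
  also have "\<dots> = ennreal (\<Sum>i\<in>I. w i * integral\<^sup>L (N i) f)"
    using w f by (intro sum_ennreal) auto
  finally show ?thesis
    using f w
    by (intro has_bochner_integral_integral_eq has_bochner_integral_nn_integral)
       (auto intro!: sum_nonneg)
qed

section \<open>Distortion of a finite set of points\<close>

definition distortion :: "real measure \<Rightarrow> real set \<Rightarrow> real" where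
  "distortion M \<alpha> = (LINT x|M. Min ((\<lambda>a. (x - a)\<^sup>2) ` \<alpha>))"

lemma quantization_error_eq:
  "quantization_error n M = Inf {distortion M \<alpha> |\<alpha>. finite \<alpha> \<and> 1 \<le> card \<alpha> \<and> card \<alpha> \<le> n}"
  by (simp add: quantization_error_def distortion_def)

lemma Min_sq_nonneg:
  fixes x :: real
  assumes "finite \<alpha>" "\<alpha> \<noteq> {}"
  shows "0 \<le> Min ((\<lambda>a. (x - a)\<^sup>2) ` \<alpha>)"
  using assms by (subst Min_ge_iff) auto

lemma borel_measurable_Min_sq:
  fixes \<alpha> :: "real set"
  assumes "finite \<alpha>" "\<alpha> \<noteq> {}" "sets M = sets borel"
  shows "(\<lambda>x. Min ((\<lambda>a. (x - a)\<^sup>2) ` \<alpha>)) \<in> borel_measurable M"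
proof -
  have "(\<lambda>x. Min ((\<lambda>a. (x - a)\<^sup>2) ` \<alpha>)) \<in> borel_measurable borel"
    using assms(1,2)
  proof (induction rule: finite_ne_induct)
    case (singleton a)
    then show ?case by simp
  next
    case (insert a F)
    then show ?case by (simp add: Min_insert)
  qed
  then show ?thesis using assms(3) measurable_cong_sets by blast
qed

text \<open>The minimum is dominated by the squared distance to any single point \<open>a\<close> of
  \<open>\<alpha>\<close>, which is almost everywhere at most
  \<open>(R + \<bar>a\<bar>)\<^sup>2\<close>.\<close>

lemma integrable_Min_sq:
  assumes "real_distribution M" "AE x in M. \<bar>x\<bar> \<le> R" "finite \<alpha>" "\<alpha> \<noteq> {}"
  shows "integrable M (\<lambda>x. Min ((\<lambda>a. (x - a)\<^sup>2) ` \<alpha>))"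
proof -
  interpret real_distribution M by fact
  obtain a where a: "a \<in> \<alpha>" using assms by auto
  have "norm (Min ((\<lambda>a. (x - a)\<^sup>2) ` \<alpha>)) \<le> (R + \<bar>a\<bar>)\<^sup>2" if "\<bar>x\<bar> \<le> R" for x
  proof -
    have "Min ((\<lambda>a. (x - a)\<^sup>2) ` \<alpha>) \<le> (x - a)\<^sup>2"
      using a assms by (intro Min_le) auto
    also have "\<dots> \<le> (R + \<bar>a\<bar>)\<^sup>2"
      using that by (intro abs_le_square_iff[THEN iffD1]) auto
    finally show ?thesis using Min_sq_nonneg[OF assms(3,4)] by simp
  qed
  then have "AE x in M. norm (Min ((\<lambda>a. (x - a)\<^sup>2) ` \<alpha>)) \<le> (R + \<bar>a\<bar>)\<^sup>2"
    using assms(2) by (auto elim: eventually_mono)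
  then show ?thesis
    using assms by (intro integrable_const_bound borel_measurable_Min_sq) auto
qed

lemma distortion_nonneg:
  assumes "finite \<alpha>" "\<alpha> \<noteq> {}"
  shows "0 \<le> distortion M \<alpha>"
  unfolding distortion_def using assms by (intro Bochner_Integration.integral_nonneg Min_sq_nonneg)

lemma distortion_antimono:
  assumes "real_distribution M" "AE x in M. \<bar>x\<bar> \<le> R" "finite \<alpha>" "\<beta> \<subseteq> \<alpha>" "\<beta> \<noteq> {}"
  shows "distortion M \<alpha> \<le> distortion M \<beta>"
  unfolding distortion_def using assms finite_subset[OF assms(4,3)]
  by (intro integral_mono integrable_Min_sq[OF assms(1,2)] Min_antimono) auto

lemma distortion_zero_le:
  assumes "real_distribution M" "AE x in M. \<bar>x\<bar> \<le> R"
  shows "distortion M {0} \<le> R\<^sup>2"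
proof -
  interpret real_distribution M by fact
  have "AE x in M. Min ((\<lambda>a. (x - a)\<^sup>2) ` {0}) \<le> R\<^sup>2"
    using assms(2) by (auto elim!: eventually_mono dest: power_mono[where n = 2])
  then show ?thesis
    unfolding distortion_def using assms
    by (intro integral_le_const integrable_Min_sq) auto
qed

text \<open>In \<open>T x - T a = r * (x - a)\<close> the shift cancels, and the nonnegative factor
  \<open>r\<^sup>2\<close> can be pulled out of the minimum.\<close>

lemma distortion_distr_affine:
  assumes M: "real_distribution M" "AE x in M. \<bar>x\<bar> \<le> R" and T: "\<And>x. T x = r * x + c"
    and \<alpha>: "finite \<alpha>" "\<alpha> \<noteq> {}"
  shows "distortion (distr M borel T) (T ` \<alpha>) = r\<^sup>2 * distortion M \<alpha>"
proof -
  interpret real_distribution M by fact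
  have Tm: "T \<in> borel_measurable M"
    by (subst ext[of T "\<lambda>x. r * x + c"]) (auto simp: T)
  have "Min ((\<lambda>a. (T x - a)\<^sup>2) ` T ` \<alpha>) = r\<^sup>2 * Min ((\<lambda>a. (x - a)\<^sup>2) ` \<alpha>)" for x
  proof -
    have "(\<lambda>a. (T x - a)\<^sup>2) ` T ` \<alpha> = (\<lambda>y. r\<^sup>2 * y) ` (\<lambda>a. (x - a)\<^sup>2) ` \<alpha>"
      by (simp add: image_image T flip: power_mult_distrib right_diff_distrib)
    moreover have "mono (\<lambda>y. r\<^sup>2 * y)" by (intro monoI mult_left_mono) auto
    ultimately show ?thesis using \<alpha> by (simp add: mono_Min_commute)
  qed
  then show ?thesis
    unfolding distortion_def using \<alpha> Tm borel_measurable_Min_sq[of "T ` \<alpha>" borel]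
    by (simp add: integral_distr)
qed

lemma real_distribution_distr_affine:
  assumes M: "real_distribution M" "AE x in M. \<bar>x\<bar> \<le> R" and T: "\<And>x. T x = r * x + c"
  shows "real_distribution (distr M borel T)"
    and "AE x in distr M borel T. \<bar>x\<bar> \<le> \<bar>r\<bar> * R + \<bar>c\<bar>"
proof -
  interpret real_distribution M by fact
  have Tm: "T \<in> borel_measurable M"
    by (subst ext[of T "\<lambda>x. r * x + c"]) (auto simp: T)
  then show "real_distribution (distr M borel T)" by simp
  have "\<bar>T x\<bar> \<le> \<bar>r\<bar> * R + \<bar>c\<bar>" if "\<bar>x\<bar> \<le> R" for x
    using mult_left_mono[OF that, of "\<bar>r\<bar>"] abs_triangle_ineq[of "r * x" c]
    by (simp add: T abs_mult)
  then show "AE x in distr M borel T. \<bar>x\<bar> \<le> \<bar>r\<bar> * R + \<bar>c\<bar>"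
    using Tm assms(2) by (auto simp: AE_distr_iff elim: eventually_mono)
qed

text \<open>The index set is arbitrary so that the two-term identity for \<open>\<nu>\<close> and
  the three-term identity for \<open>P\<close> are both instances.\<close>

lemma distortion_mixture:
  fixes w :: "'i \<Rightarrow> real"
  assumes "finite I" "\<And>i. i \<in> I \<Longrightarrow> 0 \<le> w i" "real_distribution M"
    and N: "\<And>i. i \<in> I \<Longrightarrow> real_distribution (N i) \<and> (\<exists>R. AE x in N i. \<bar>x\<bar> \<le> R)"
    and "\<And>A. A \<in> sets borel \<Longrightarrow> measure M A = (\<Sum>i\<in>I. w i * measure (N i) A)"
    and \<alpha>: "finite \<alpha>" "\<alpha> \<noteq> {}"
  shows "distortion M \<alpha> = (\<Sum>i\<in>I. w i * distortion (N i) \<alpha>)"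
proof -
  interpret M: real_distribution M by fact
  have "finite_measure (N i)" "sets (N i) = sets M" if "i \<in> I" for i
    using N[OF that]
    by (auto simp: real_distribution_def real_distribution_axioms_def prob_space_def)
  moreover have "integrable (N i) (\<lambda>x. Min ((\<lambda>a. (x - a)\<^sup>2) ` \<alpha>))" if "i \<in> I" for i
    using N[OF that] \<alpha> integrable_Min_sq by blast
  ultimately show ?thesis
    unfolding distortion_def using assms M.finite_measure_axioms
    by (intro integral_mixture borel_measurable_Min_sq Min_sq_nonneg) auto
qed

lemma quantization_error_le:
  assumes "finite \<alpha>" "\<alpha> \<noteq> {}" "card \<alpha> \<le> n"
  shows "quantization_error n M \<le> distortion M \<alpha>"
  unfolding quantization_error_eq
  using assms
  by (intro cInf_lower bdd_belowI[of _ 0])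
     (auto intro!: exI[of _ \<alpha>] distortion_nonneg simp: Suc_le_eq card_gt_0_iff)

text \<open>The condition \<open>n \<ge> 1\<close> keeps the set of distortions nonempty; its
  infimum would otherwise carry no information.\<close>

lemma le_quantization_error:
  assumes "n \<ge> 1" "\<And>\<alpha>. finite \<alpha> \<Longrightarrow> \<alpha> \<noteq> {} \<Longrightarrow> card \<alpha> \<le> n \<Longrightarrow> c \<le> distortion M \<alpha>"
  shows "c \<le> quantization_error n M"
  unfolding quantization_error_eq
proof (intro cInf_greatest)
  show "{distortion M \<alpha> |\<alpha>. finite \<alpha> \<and> 1 \<le> card \<alpha> \<and> card \<alpha> \<le> n} \<noteq> {}"
    using assms(1) by (auto intro!: exI[of _ "{0}"])
qed (use assms(2) in \<open>force\<close>)

text \<open>The closed \<open>\<delta>\<close>-intervals around the points of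
  \<open>\<alpha>\<close> have total mass at most \<open>1/2\<close>. On the remaining mass, at
  least \<open>1/2\<close>, the integrand is at least \<open>\<delta>\<^sup>2\<close>.\<close>

lemma distortion_lower_bound:
  assumes "real_distribution M" "AE x in M. \<bar>x\<bar> \<le> R" "\<delta> > 0"
    and small: "\<And>a. measure M {a - \<delta>..a + \<delta>} \<le> p"
    and \<alpha>: "finite \<alpha>" "\<alpha> \<noteq> {}" and card: "real (card \<alpha>) * p \<le> 1/2"
  shows "\<delta>\<^sup>2 / 2 \<le> distortion M \<alpha>"
proof -
  interpret real_distribution M by fact
  let ?f = "\<lambda>x. Min ((\<lambda>a. (x - a)\<^sup>2) ` \<alpha>)"
  let ?U = "\<Union>a\<in>\<alpha>. {a - \<delta>..a + \<delta>}"
  have U: "?U \<in> events" using \<alpha> by auto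
  have "prob ?U \<le> (\<Sum>a\<in>\<alpha>. prob {a - \<delta>..a + \<delta>})"
    using \<alpha> by (intro finite_measure_subadditive_finite) auto
  also have "\<dots> \<le> real (card \<alpha>) * p"
    using small sum_bounded_above[of \<alpha> "\<lambda>a. prob {a - \<delta>..a + \<delta>}" p] by simp
  finally have half: "1/2 \<le> prob (space M - ?U)"
    using card prob_compl[OF U] by simp
  have "\<delta>\<^sup>2 \<le> ?f x" if "x \<notin> ?U" for x
  proof -
    have "\<delta>\<^sup>2 \<le> (x - a)\<^sup>2" if "a \<in> \<alpha>" for a
      using \<open>x \<notin> ?U\<close> that \<open>\<delta> > 0\<close>
      by (intro abs_le_square_iff[THEN iffD1]) (force simp: abs_if)
    then show ?thesis using \<alpha> by (subst Min_ge_iff) auto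
  qed
  then have "\<delta>\<^sup>2 * indicator (space M - ?U) x \<le> ?f x" for x
    using Min_sq_nonneg[OF \<alpha>] by (cases "x \<in> ?U") (simp_all add: indicator_def)
  moreover have "integrable M (\<lambda>x. \<delta>\<^sup>2 * indicator (space M - ?U) x :: real)"
    using U by (intro integrable_mult_right integrable_real_indicator)
      (auto simp: less_top[symmetric])
  ultimately have "(LINT x|M. \<delta>\<^sup>2 * indicator (space M - ?U) x) \<le> (LINT x|M. ?f x)"
    using \<alpha> by (intro integral_mono integrable_Min_sq[OF assms(1,2)])
  with half show ?thesis
    using mult_left_mono[of "1/2" "prob (space M - ?U)" "\<delta>\<^sup>2"] U
    unfolding distortion_def by simp
qed

section \<open>The Cantor measure and the condensation measure\<close>

context
  fixes \<nu> :: "real measure"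
  assumes \<nu>: "is_self_similar_measure \<nu>"
begin

interpretation real_distribution \<nu>
  using \<nu> by (simp add: is_self_similar_measure_def compactly_supported_distribution_def)

lemma measure_self_similar:
  assumes "A \<in> sets borel"
  shows "measure \<nu> A = 1/2 * measure \<nu> (T\<^sub>1 -` A) + 1/2 * measure \<nu> (T\<^sub>2 -` A)"
proof -
  have "T\<^sub>1 \<in> borel_measurable \<nu>" "T\<^sub>2 \<in> borel_measurable \<nu>"
    unfolding T\<^sub>1_def[abs_def] T\<^sub>2_def[abs_def] by measurable
  then show ?thesis
    using \<nu> assms by (simp add: is_self_similar_measure_def measure_distr)
qed

text \<open>The endpoints \<open>2/5\<close> and \<open>3/5\<close> are the fixed points of
  \<open>T\<^sub>1\<close> and \<open>T\<^sub>2\<close>. Both maps send the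
  \<open>e\<close>-neighbourhood of this interval into its \<open>e/3\<close>-neighbourhood, so
  self-similarity passes full measure on to ever smaller neighbourhoods.\<close>

lemma AE_in_Cantor_hull: "AE x in \<nu>. x \<in> {2/5..3/5}"
proof -
  obtain R where R: "R > 0" "AE x in \<nu>. \<bar>x\<bar> \<le> R"
    using compactly_supported_distribution_bounded \<nu> unfolding is_self_similar_measure_def by blast
  \<comment> \<open>The margin \<open>R + 1\<close> makes \<open>A 0\<close> contain all of
    \<open>{-R..R}\<close>.\<close>
  define A where "A k = {2/5 - (R + 1) / 3^k..3/5 + (R + 1) / 3^k}" for k :: nat
  have "prob (A k) = 1" for k
  proof (induction k)
    case 0
    have "AE x in \<nu>. x \<in> A 0"
      using R(2) by eventually_elim (auto simp: A_def)
    then show ?case by (subst prob_eq_1) (auto simp: A_def)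
  next
    case (Suc k)
    define e where "e = (R + 1) / 3 ^ k"
    have "e > 0" "A k = {2/5 - e..3/5 + e}" "A (Suc k) = {2/5 - e/3..3/5 + e/3}"
      using R(1) by (simp_all add: A_def e_def)
    then have "A k \<subseteq> T\<^sub>1 -` A (Suc k)" "A k \<subseteq> T\<^sub>2 -` A (Suc k)"
      by (auto simp: T\<^sub>1_def T\<^sub>2_def)
    moreover have "T\<^sub>1 -` A (Suc k) \<in> events" "T\<^sub>2 -` A (Suc k) \<in> events"
      unfolding A_def events_eq_borel
      by (auto intro!: borel_closed closed_vimage simp: T\<^sub>1_def[abs_def] T\<^sub>2_def[abs_def] continuous_intros)
    ultimately have "prob (T\<^sub>1 -` A (Suc k)) = 1" "prob (T\<^sub>2 -` A (Suc k)) = 1"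
      using Suc finite_measure_mono prob_le_1 by (metis order_antisym)+
    then show ?case by (subst measure_self_similar) (auto simp: A_def)
  qed
  then have "AE x in \<nu>. x \<in> A k" for k
    by (subst prob_eq_1[symmetric]) (auto simp: A_def)
  then have "AE x in \<nu>. \<forall>k. x \<in> A k" by (simp add: AE_all_countable)
  then show ?thesis
  proof (rule eventually_mono)
    fix x assume x: "\<forall>k. x \<in> A k"
    have "(\<lambda>k. 2/5 - (R + 1) / 3^k) \<longlonglongrightarrow> 2/5"
      by real_asymp
    then have "2/5 \<le> x"
      by (rule LIMSEQ_le_const2) (use x in \<open>simp add: A_def\<close>)
    moreover have "(\<lambda>k. 3/5 + (R + 1) / 3^k) \<longlonglongrightarrow> 3/5"
      by real_asymp
    then have "x \<le> 3/5"
      by (rule LIMSEQ_le_const) (use x in \<open>simp add: A_def\<close>)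
    ultimately show "x \<in> {2/5..3/5}"
      by simp
  qed
qed

text \<open>An interval shorter than the gap \<open>1/15\<close> between \<open>T\<^sub>1 [2/5, 3/5]\<close> and \<open>T\<^sub>2 [2/5, 3/5]\<close> meets only
  one of the two pieces, so enlarging it threefold at least doubles its measure.\<close>

lemma Cantor_interval_measure_le:
  "b - a \<le> (1/3)^k / 20 \<Longrightarrow> measure \<nu> {a..b} \<le> (1/2)^k"
proof (induction k arbitrary: a b)
  case 0
  then show ?case by simp
next
  case (Suc k)
  have T: "T\<^sub>1 -` {a..b} = {3*a - 4/5..3*b - 4/5}" "T\<^sub>2 -` {a..b} = {3*a - 6/5..3*b - 6/5}"
    by (auto simp: T\<^sub>1_def T\<^sub>2_def)
  have half: "prob {a..b} = 1/2 * prob {3*a - 4/5..3*b - 4/5} + 1/2 * prob {3*a - 6/5..3*b - 6/5}"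
    using measure_self_similar[of "{a..b}"] by (simp add: T)
  have IH: "prob {3*a - 4/5..3*b - 4/5} \<le> (1/2)^k" "prob {3*a - 6/5..3*b - 6/5} \<le> (1/2)^k"
    using Suc.prems by (intro Suc.IH; simp)+
  have null: "prob {c..d} = 0" if "d < 2/5 \<or> c > 3/5" for c d
  proof (subst prob_eq_0)
    show "AE x in \<nu>. x \<notin> {c..d}"
      using AE_in_Cantor_hull by eventually_elim (use that in auto)
  qed auto
  have "(1/3::real)^k \<le> 1" by (intro power_le_one) auto
  with Suc.prems have "b - a < 1/15" by simp
  \<comment> \<open>\<open>7/15\<close> is the right end of \<open>T\<^sub>1 [2/5, 3/5]\<close> and
    \<open>8/15\<close> the left end of \<open>T\<^sub>2 [2/5, 3/5]\<close>. In either case one of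
    the two preimages lies outside the hull and is null.\<close>
  then consider "b < 8/15" | "a > 7/15" by linarith
  then show ?case
  proof cases
    case 1
    then show ?thesis using half IH null[of "3*b - 6/5" "3*a - 6/5"] by simp
  next
    case 2
    then show ?thesis using half IH null[of "3*b - 4/5" "3*a - 4/5"] by simp
  qed
qed

text \<open>Taking \<open>\<delta> = (1/3)^k / 40\<close> gives intervals of length
  \<open>(1/3)^k / 20\<close>, each of mass at most \<open>(1/2)^k\<close>, and
  \<open>\<delta>\<^sup>2 / 2\<close> is the stated bound.\<close>

lemma Cantor_distortion_ge:
  assumes "finite \<alpha>" "\<alpha> \<noteq> {}" "2 * card \<alpha> \<le> 2 ^ k"
  shows "1/3200 * (1/9)^k \<le> distortion \<nu> \<alpha>"
proof -
  have "AE x in \<nu>. \<bar>x\<bar> \<le> 3/5"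
    using AE_in_Cantor_hull by eventually_elim auto
  note bound = distortion_lower_bound[OF real_distribution_axioms this]
  have "real (card \<alpha>) * (1/2)^k \<le> 1/2"
  proof -
    have "real (2 * card \<alpha>) \<le> real (2 ^ k)" using assms(3) by (rule of_nat_mono)
    then show ?thesis by (simp add: field_simps)
  qed
  then have "((1/3)^k / 40)\<^sup>2 / 2 \<le> distortion \<nu> \<alpha>"
    using assms by (intro bound[where p = "(1/2)^k"] Cantor_interval_measure_le) auto
  moreover have "((1/3::real)^k)\<^sup>2 = (1/9)^k"
    by (simp add: power_mult[symmetric] mult.commute[of k] power_mult power_divide)
  ultimately show ?thesis by (simp add: power_divide)
qed

text \<open>Starting from \<open>{0}\<close>, each passage from \<open>\<beta>\<close> to the union
  of its two images at most doubles the number of points and divides the distortion bound by 9: each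
  image measure is charged to its own copy of \<open>\<beta>\<close>, as further points can only
  lower the distortion.\<close>

lemma Cantor_quantizer:
  assumes "AE x in \<nu>. \<bar>x\<bar> \<le> R"
  shows "\<exists>\<alpha>. finite \<alpha> \<and> \<alpha> \<noteq> {} \<and> card \<alpha> \<le> 2 ^ k \<and> distortion \<nu> \<alpha> \<le> R\<^sup>2 * (1/9)^k"
proof (induction k)
  case 0
  show ?case
    using distortion_zero_le[OF real_distribution_axioms assms] by (intro exI[of _ "{0}"]) auto
next
  case (Suc k)
  then obtain \<beta> where \<beta>: "finite \<beta>" "\<beta> \<noteq> {}" "card \<beta> \<le> 2 ^ k" "distortion \<nu> \<beta> \<le> R\<^sup>2 * (1/9)^k"
    by blast
  note D1 = real_distribution_distr_affine[OF real_distribution_axioms assms, of T\<^sub>1 "1/3" "4/15", OF T\<^sub>1_def]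
  note D2 = real_distribution_distr_affine[OF real_distribution_axioms assms, of T\<^sub>2 "1/3" "2/5", OF T\<^sub>2_def]
  let ?\<alpha> = "T\<^sub>1 ` \<beta> \<union> T\<^sub>2 ` \<beta>"
  let ?N = "\<lambda>i::bool. distr \<nu> borel (if i then T\<^sub>1 else T\<^sub>2)"
  have "distortion \<nu> ?\<alpha> = (\<Sum>i\<in>UNIV. 1/2 * distortion (?N i) ?\<alpha>)"
    using \<nu> \<beta> D1 D2
    by (intro distortion_mixture real_distribution_axioms)
       (auto simp: is_self_similar_measure_def UNIV_bool)
  also have "\<dots> = 1/2 * distortion (distr \<nu> borel T\<^sub>1) ?\<alpha> + 1/2 * distortion (distr \<nu> borel T\<^sub>2) ?\<alpha>"
    by (simp add: UNIV_bool)
  also have "\<dots> \<le> 1/2 * distortion (distr \<nu> borel T\<^sub>1) (T\<^sub>1 ` \<beta>) + 1/2 * distortion (distr \<nu> borel T\<^sub>2) (T\<^sub>2 ` \<beta>)"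
    using \<beta> by (intro add_mono mult_left_mono distortion_antimono[OF D1] distortion_antimono[OF D2]) auto
  also have "\<dots> = 1/9 * distortion \<nu> \<beta>"
    using distortion_distr_affine[OF real_distribution_axioms assms T\<^sub>1_def \<beta>(1,2)]
      distortion_distr_affine[OF real_distribution_axioms assms T\<^sub>2_def \<beta>(1,2)]
    by (simp add: power2_eq_square)
  also have "\<dots> \<le> R\<^sup>2 * (1/9)^Suc k" using \<beta>(4) by simp
  finally have "distortion \<nu> ?\<alpha> \<le> R\<^sup>2 * (1/9)^Suc k" .
  moreover have "card ?\<alpha> \<le> 2 ^ Suc k"
    using card_Un_le[of "T\<^sub>1 ` \<beta>" "T\<^sub>2 ` \<beta>"] card_image_le[OF \<beta>(1), of T\<^sub>1] card_image_le[OF \<beta>(1), of T\<^sub>2] \<beta>(3)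
    by simp
  ultimately show ?case using \<beta> by (intro exI[of _ ?\<alpha>]) auto
qed

section \<open>Distortion bounds for the condensation measure \<open>P\<close>\<close>

context
  fixes P :: "real measure"
  assumes P: "is_condensation_measure \<nu> P"
begin

interpretation P: real_distribution P
  using P by (simp add: is_condensation_measure_def compactly_supported_distribution_def)

lemma distortion_condensation:
  assumes "AE x in \<nu>. \<bar>x\<bar> \<le> R" "AE x in P. \<bar>x\<bar> \<le> R" "finite \<alpha>" "\<alpha> \<noteq> {}"
  shows "distortion P \<alpha> = 1/3 * distortion (distr P borel S\<^sub>1) \<alpha>
    + 1/3 * distortion (distr P borel S\<^sub>2) \<alpha> + 1/3 * distortion \<nu> \<alpha>"
proof -
  have S1: "\<And>x. S\<^sub>1 x = 1/5 * x + 0" by (simp add: S\<^sub>1_def)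
  note D1 = real_distribution_distr_affine[OF P.real_distribution_axioms assms(2), of S\<^sub>1, OF S1]
  note D2 = real_distribution_distr_affine[OF P.real_distribution_axioms assms(2), of S\<^sub>2 "1/5" "4/5", OF S\<^sub>2_def]
  let ?N = "\<lambda>i::nat. if i = 0 then distr P borel S\<^sub>1 else if i = 1 then distr P borel S\<^sub>2 else \<nu>"
  have "distortion P \<alpha> = (\<Sum>i\<in>{0,1,2}. 1/3 * distortion (?N i) \<alpha>)"
  proof (rule distortion_mixture)
    show "real_distribution (?N i) \<and> (\<exists>R. AE x in ?N i. \<bar>x\<bar> \<le> R)" for i
      using D1 D2 real_distribution_axioms assms(1) by (simp only: split: if_split) blast
    show "measure P A = (\<Sum>i\<in>{0,1,2}. 1/3 * measure (?N i) A)" if "A \<in> sets borel" for A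
      using P that by (simp add: is_condensation_measure_def)
  qed (use assms P.real_distribution_axioms in simp_all)
  then show ?thesis by simp
qed

lemma condensation_distortion_ge:
  assumes "finite \<alpha>" "\<alpha> \<noteq> {}" "AE x in \<nu>. \<bar>x\<bar> \<le> R" "AE x in P. \<bar>x\<bar> \<le> R"
  shows "distortion \<nu> \<alpha> / 3 \<le> distortion P \<alpha>"
  using distortion_condensation[OF assms(3,4,1,2)] distortion_nonneg[OF assms(1,2)] by simp

text \<open>Two copies of the previous quantizer and \<open>2 ^ (k + 1)\<close> fresh points for
  \<open>\<nu>\<close> give the count
  \<open>2 * (k + 1) * 2 ^ k + 2 ^ (k + 1) = (k + 2) * 2 ^ (k + 1)\<close>; this recurrence is the
  source of the factor \<open>k + 1\<close>.\<close>

lemma condensation_quantizer: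
  assumes R: "AE x in \<nu>. \<bar>x\<bar> \<le> R" "AE x in P. \<bar>x\<bar> \<le> R"
  shows "\<exists>\<alpha>. finite \<alpha> \<and> \<alpha> \<noteq> {} \<and> card \<alpha> \<le> (k + 1) * 2 ^ k \<and> distortion P \<alpha> \<le> R\<^sup>2 * (1/9)^k"
proof (induction k)
  case 0
  show ?case
    using distortion_zero_le[OF P.real_distribution_axioms R(2)] by (intro exI[of _ "{0}"]) auto
next
  case (Suc k)
  then obtain \<beta> where \<beta>: "finite \<beta>" "\<beta> \<noteq> {}" "card \<beta> \<le> (k + 1) * 2 ^ k"
    "distortion P \<beta> \<le> R\<^sup>2 * (1/9)^k"
    by blast
  \<comment> \<open>\<open>\<gamma>\<close> is taken one level above \<open>\<beta>\<close>, so its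
    error is already within the target.\<close>
  obtain \<gamma> where \<gamma>: "finite \<gamma>" "\<gamma> \<noteq> {}" "card \<gamma> \<le> 2 ^ Suc k" "distortion \<nu> \<gamma> \<le> R\<^sup>2 * (1/9)^Suc k"
    using Cantor_quantizer[OF R(1)] by blast
  have S1: "\<And>x. S\<^sub>1 x = 1/5 * x + 0" by (simp add: S\<^sub>1_def)
  note D1 = real_distribution_distr_affine[OF P.real_distribution_axioms R(2), of S\<^sub>1, OF S1]
  note D2 = real_distribution_distr_affine[OF P.real_distribution_axioms R(2), of S\<^sub>2, OF S\<^sub>2_def]
  let ?\<alpha> = "S\<^sub>1 ` \<beta> \<union> S\<^sub>2 ` \<beta> \<union> \<gamma>"
  have "distortion P ?\<alpha> = 1/3 * distortion (distr P borel S\<^sub>1) ?\<alpha>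
      + 1/3 * distortion (distr P borel S\<^sub>2) ?\<alpha> + 1/3 * distortion \<nu> ?\<alpha>"
    using \<beta> \<gamma> by (intro distortion_condensation[OF R]) auto
  also have "\<dots> \<le> 1/3 * distortion (distr P borel S\<^sub>1) (S\<^sub>1 ` \<beta>)
      + 1/3 * distortion (distr P borel S\<^sub>2) (S\<^sub>2 ` \<beta>) + 1/3 * distortion \<nu> \<gamma>"
    using \<beta> \<gamma>
    by (intro add_mono mult_left_mono distortion_antimono[OF D1] distortion_antimono[OF D2]
        distortion_antimono[OF real_distribution_axioms R(1)]) auto
  also have "\<dots> = 2/75 * distortion P \<beta> + 1/3 * distortion \<nu> \<gamma>"
    using distortion_distr_affine[OF P.real_distribution_axioms R(2) S1 \<beta>(1,2)]
      distortion_distr_affine[OF P.real_distribution_axioms R(2) S\<^sub>2_def \<beta>(1,2)]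
    by (simp add: power2_eq_square)
  \<comment> \<open>In units of \<open>R\<^sup>2 * (1/9)^k\<close> this says
    \<open>2/75 + 1/27 \<le> 1/9\<close>.\<close>
  also have "\<dots> \<le> R\<^sup>2 * (1/9)^Suc k"
  proof -
    have "0 \<le> R\<^sup>2 * (1/9)^k" by simp
    moreover have "R\<^sup>2 * (1/9)^Suc k = R\<^sup>2 * (1/9)^k / 9" by simp
    ultimately show ?thesis using \<beta>(4) \<gamma>(4) by linarith
  qed
  finally have "distortion P ?\<alpha> \<le> R\<^sup>2 * (1/9)^Suc k" .
  moreover have "card ?\<alpha> \<le> (Suc k + 1) * 2 ^ Suc k"
    using card_Un_le[of "S\<^sub>1 ` \<beta> \<union> S\<^sub>2 ` \<beta>" \<gamma>] card_Un_le[of "S\<^sub>1 ` \<beta>" "S\<^sub>2 ` \<beta>"]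
      card_image_le[OF \<beta>(1), of S\<^sub>1] card_image_le[OF \<beta>(1), of S\<^sub>2] \<beta>(3) \<gamma>(3)
    by (simp add: algebra_simps)
  ultimately show ?case using \<beta> \<gamma> by (intro exI[of _ ?\<alpha>]) auto
qed

end

end

section \<open>From geometric bounds to the dimension\<close>

text \<open>For each \<open>n\<close> a suitable level \<open>k\<close> is
  \<open>ln n / ln 2\<close> up to an error of order \<open>ln (ln n)\<close>, so
  \<open>- ln (V n)\<close> is asymptotic to \<open>2 * ln 3 / ln 2 * ln n\<close>.\<close>

lemma log_ratio_tendsto:
  fixes V :: "nat \<Rightarrow> real" and c C :: real
  assumes "c > 0" "C > 0"
    and lower: "\<And>n k. n \<ge> 1 \<Longrightarrow> 2 * n \<le> 2 ^ k \<Longrightarrow> c * (1/9)^k \<le> V n"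
    and upper: "\<And>n k. (k + 1) * 2 ^ k \<le> n \<Longrightarrow> V n \<le> C * (1/9)^k"
  shows "(\<lambda>n. 2 * ln (real n) / (- ln (V n))) \<longlonglongrightarrow> ln 2 / ln 3"
proof -
  have ln9: "ln (9::real) = 2 * ln 3" using ln_realpow[of 3 2] by simp
  \<comment> \<open>\<open>U\<close> comes from \<open>2 ^ k \<le> 4 * n\<close>, and
    \<open>L\<close> from \<open>n < (k + 2) * 2 ^ (k + 1)\<close> together with
    \<open>2 ^ k \<le> n\<close>.\<close>
  define U where "U x = (2 * ln 3 / ln 2) * (ln x + ln 4) - ln c" for x :: real
  define L where "L x = (2 * ln 3 / ln 2) * (ln x - ln (ln x / ln 2 + 2) - ln 2) - ln C" for x :: real
  have le_U: "V n > 0 \<and> - ln (V n) \<le> U (real n)" if n: "n \<ge> 1" for n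
  proof -
    \<comment> \<open>The least admissible level still satisfies \<open>2 ^ k < 4 * n\<close>, which
      bounds \<open>k\<close> from above. The lower bound on \<open>V n\<close> also yields its
      positivity, used again for \<open>L\<close>.\<close>
    define k where "k = (LEAST k. 2 * n \<le> 2 ^ k)"
    have ex: "2 * n \<le> 2 ^ (2 * n)" by (rule less_imp_le[OF less_exp])
    have k: "2 * n \<le> 2 ^ k" unfolding k_def using ex by (rule LeastI)
    with n have "k \<noteq> 0" by (intro notI) simp
    then have "\<not> 2 * n \<le> 2 ^ (k - 1)"
      using not_less_Least[of "k - 1" "\<lambda>k. 2 * n \<le> 2 ^ k"] unfolding k_def by simp
    then have "2 ^ Suc (k - 1) < 4 * n" by simp
    then have "real (2 ^ k) \<le> real (4 * n)" using \<open>k \<noteq> 0\<close> by (intro of_nat_mono) simp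
    then have "ln (2 ^ k :: real) \<le> ln (4 * real n)" using n by simp
    then have kle: "real k \<le> (ln n + ln 4) / ln 2"
      using n by (simp add: ln_realpow ln_mult field_simps)
    have V: "c * (1/9)^k \<le> V n" using n k by (rule lower)
    have pos: "0 < c * (1/9)^k" using assms by simp
    with V have "ln (c * (1/9)^k) \<le> ln (V n)" by simp
    then have "- ln (V n) \<le> 2 * ln 3 * real k - ln c"
      using assms(1) by (simp add: ln_mult ln_realpow ln_div ln9 mult_ac)
    also have "\<dots> \<le> U n"
      using mult_left_mono[OF kle, of "2 * ln 3"] by (simp add: U_def)
    finally show ?thesis using pos V by linarith
  qed
  have L_le: "L (real n) \<le> - ln (V n)" if n: "n \<ge> 1" for n
  proof -
    \<comment> \<open>The first level that is too large for \<open>n\<close>; its predecessor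
      \<open>k\<close> is the level to which \<open>upper\<close> applies.\<close>
    define m where "m = (LEAST m. n < (m + 1) * 2 ^ m)"
    have ex: "n < (n + 1) * 2 ^ n"
      by (rule less_le_trans[of _ "(n + 1) * 1"]) (simp, intro mult_le_mono2, simp)
    have m: "n < (m + 1) * 2 ^ m" unfolding m_def using ex by (rule LeastI)
    with n have "m \<noteq> 0" by (intro notI) simp
    then obtain k where k: "m = Suc k" by (cases m) auto
    have kn: "(k + 1) * 2 ^ k \<le> n"
      using not_less_Least[of k "\<lambda>m. n < (m + 1) * 2 ^ m"] k unfolding m_def by simp
    have "2 ^ k \<le> (k + 1) * 2 ^ k" by simp
    with kn have "real (2 ^ k) \<le> real n" using order_trans by (intro of_nat_mono) blast
    then have "ln (2 ^ k :: real) \<le> ln n" using n by simp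
    then have "real k \<le> ln n / ln 2" by (simp add: ln_realpow field_simps)
    \<comment> \<open>The bound on \<open>n\<close> below involves \<open>k\<close> inside a
      logarithm as well; the crude estimate \<open>k \<le> ln n / ln 2\<close> replaces that
      occurrence by a function of \<open>n\<close>.\<close>
    then have "ln (real k + 2) \<le> ln (ln n / ln 2 + 2)" by simp
    moreover have "ln n \<le> ln (real k + 2) + (real k + 1) * ln 2"
    proof -
      have "real n \<le> real ((k + 2) * 2 ^ Suc k)"
        using m k by (intro of_nat_mono) simp
      then have "ln n \<le> ln (real ((k + 2) * 2 ^ Suc k))"
        using n by (subst ln_le_cancel_iff) auto
      also have "\<dots> = ln ((real k + 2) * 2 ^ Suc k)" by (simp add: algebra_simps)
      also have "\<dots> = ln (real k + 2) + (real k + 1) * ln 2"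
        by (subst ln_mult) (auto simp del: power_Suc simp: ln_realpow add.commute)
      finally show ?thesis .
    qed
    ultimately have kge: "(ln n - ln (ln n / ln 2 + 2) - ln 2) / ln 2 \<le> real k"
      by (simp add: pos_divide_le_eq algebra_simps)
    have "V n > 0" using le_U n by simp
    then have "ln (V n) \<le> ln (C * (1/9)^k)" using upper[OF kn] by simp
    then have "- ln (V n) \<ge> 2 * ln 3 * real k - ln C"
      using assms(2) by (simp add: ln_mult ln_realpow ln_div ln9 mult_ac)
    then show ?thesis
      using mult_left_mono[OF kge, of "2 * ln 3"] by (simp add: L_def)
  qed
  \<comment> \<open>Positivity of \<open>L\<close> makes all three denominators positive, so taking
    quotients reverses the inequalities between them.\<close>
  have L_pos: "\<forall>\<^sub>F n in sequentially. L (real n) > 0"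
    unfolding L_def by real_asymp
  have evs: "\<forall>\<^sub>F n in sequentially. 2 * ln (real n) / U (real n) \<le> 2 * ln (real n) / (- ln (V n))
      \<and> 2 * ln (real n) / (- ln (V n)) \<le> 2 * ln (real n) / L (real n)"
    using L_pos eventually_ge_at_top[of 1]
  proof eventually_elim
    case (elim n)
    moreover have "- ln (V n) \<le> U n" "L n \<le> - ln (V n)" "0 \<le> 2 * ln (real n)"
      using le_U L_le elim by simp_all
    ultimately have "0 < - ln (V n)" "- ln (V n) \<le> U n" "L n \<le> - ln (V n)" "0 \<le> 2 * ln (real n)"
      by linarith+
    then show ?case using elim by (intro conjI divide_left_mono mult_pos_pos) linarith+
  qed
  show ?thesis
  proof (rule tendsto_sandwich)
    show "(\<lambda>n. 2 * ln (real n) / U (real n)) \<longlonglongrightarrow> ln 2 / ln 3"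
      unfolding U_def by real_asymp
    show "(\<lambda>n. 2 * ln (real n) / L (real n)) \<longlonglongrightarrow> ln 2 / ln 3"
      unfolding L_def by real_asymp
  qed (rule eventually_mono[OF evs], erule conjunct1 conjunct2)+
qed

section \<open>The quantization dimensions of \<open>\<nu>\<close> and \<open>P\<close>\<close>

theorem theorem3p4p1:
  fixes \<nu> P :: "real measure"
  assumes "is_self_similar_measure \<nu>"
    and "is_condensation_measure \<nu> P"
  shows "(\<lambda>n. 2 * ln (real n) / (- ln (quantization_error n P)))
           \<longlonglongrightarrow> quantization_dim \<nu>
         \<and> quantization_dim_exists P \<and> quantization_dim P = quantization_dim \<nu>
         \<and> quantization_dim_exists \<nu> \<and> quantization_dim \<nu> = ln 2 / ln 3"
proof -
  obtain R1 R2 where R1: "R1 > 0" "AE x in \<nu>. \<bar>x\<bar> \<le> R1" and R2: "R2 > 0" "AE x in P. \<bar>x\<bar> \<le> R2"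
    using assms compactly_supported_distribution_bounded
    unfolding is_self_similar_measure_def is_condensation_measure_def by metis
  define R where "R = max R1 R2"
  have R: "R > 0" "AE x in \<nu>. \<bar>x\<bar> \<le> R" "AE x in P. \<bar>x\<bar> \<le> R"
    using R1 R2 by (auto simp: R_def elim: eventually_mono)
  have "quantization_ratio \<nu> \<longlonglongrightarrow> ln 2 / ln 3"
    unfolding quantization_ratio_def[abs_def]
  proof (rule log_ratio_tendsto)
    show "1/3200 * (1/9)^k \<le> quantization_error n \<nu>" if "n \<ge> 1" "2 * n \<le> 2 ^ k" for n k
      using that by (intro le_quantization_error Cantor_distortion_ge[OF assms(1)]) auto
    \<comment> \<open>For \<open>\<nu>\<close> already \<open>2 ^ k\<close> points suffice; the
      larger threshold is the form shared with \<open>P\<close>, so that one limit lemma serves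
      both.\<close>
    show "quantization_error n \<nu> \<le> R\<^sup>2 * (1/9)^k" if n: "(k + 1) * 2 ^ k \<le> n" for n k
    proof -
      obtain \<alpha> where \<alpha>: "finite \<alpha>" "\<alpha> \<noteq> {}" "card \<alpha> \<le> 2 ^ k" "distortion \<nu> \<alpha> \<le> R\<^sup>2 * (1/9)^k"
        using Cantor_quantizer[OF assms(1) R(2)] by blast
      have "card \<alpha> \<le> n" using \<alpha>(3) n by simp
      then show ?thesis using quantization_error_le \<alpha> order_trans by blast
    qed
  qed (use R in auto)
  moreover have "quantization_ratio P \<longlonglongrightarrow> ln 2 / ln 3"
    unfolding quantization_ratio_def[abs_def]
  proof (rule log_ratio_tendsto)
    \<comment> \<open>The constant is a third of the \<open>1/3200\<close> for \<open>\<nu>\<close>,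
      the weight of \<open>\<nu>\<close> in \<open>P\<close> being \<open>1/3\<close>.\<close>
    show "1/9600 * (1/9)^k \<le> quantization_error n P" if "n \<ge> 1" "2 * n \<le> 2 ^ k" for n k
    proof (rule le_quantization_error[OF that(1)])
      fix \<alpha> :: "real set" assume \<alpha>: "finite \<alpha>" "\<alpha> \<noteq> {}" "card \<alpha> \<le> n"
      then show "1/9600 * (1/9)^k \<le> distortion P \<alpha>"
        using condensation_distortion_ge[OF assms \<alpha>(1,2) R(2,3)]
          Cantor_distortion_ge[OF assms(1) \<alpha>(1,2), of k] that by simp
    qed
    show "quantization_error n P \<le> R\<^sup>2 * (1/9)^k" if n: "(k + 1) * 2 ^ k \<le> n" for n k
      using condensation_quantizer[OF assms R(2,3), of k] n quantization_error_le order_trans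
      by meson
  qed (use R in auto)
  ultimately show ?thesis
    unfolding quantization_dim_def quantization_dim_exists_def convergent_def
      quantization_ratio_def[abs_def]
    by (auto simp del: divide_minus_right simp: limI)
qed

end
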